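(* Let $k \geq 2$ be an integer, let $F_n^{(k)}$ denote the $n$-th $k$-generalized Fibonacci number, and let $\alpha$ be the unique positive real root of $x^k - x^{k-1} - \cdots - x - 1 = 0$. Then for all integers $n \geq 2-k$, $$F_n^{(k)} = \mathrm{Round}\left[ \frac{\alpha - 1}{2 + (k+1)(\alpha - 2)}\, \alpha^{n-1} \right].$$
   Context: For an integer $k \geq 2$, the $k$-generalized Fibonacci numbers $F_n^{(k)}$ (for integers $n \geq 2-k$) are defined by the $k$ initial values $F_n^{(k)} = 0$ for $2-k \leq n \leq 0$ and $F_1^{(k)} = 1$, together with the recurrence $F_n^{(k)} = F_{n-1}^{(k)} + F_{n-2}^{(k)} + \cdots + F_{n-k}^{(k)}$ for all $n \geq 2$. For a real number $x$, $\mathrm{Round}[x]$ denotes the integer closest to $x$. *)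

theory Defs
  imports Complex_Main
begin

text \<open>
  The sequence is indexed by the integers. Only the indices \<^term>\<open>n \<ge> 2 - int k\<close> are meaningful;
  below that range the value \<open>0\<close> is a dummy, never reached by the recurrence.
\<close>

function gen_fib :: "nat \<Rightarrow> int \<Rightarrow> int" where
  "gen_fib k n =
     (if n \<le> 0 then 0 else if n = 1 then 1 else (\<Sum>i=1..k. gen_fib k (n - int i)))"
  by pat_completeness auto
termination
  by (relation "measure (\<lambda>(k, n). nat n)") auto

declare gen_fib.simps [simp del]

lemma gen_fib_nonpos: "2 - int k \<le> n \<Longrightarrow> n \<le> 0 \<Longrightarrow> gen_fib k n = 0"
  by (simp add: gen_fib.simps)

lemma gen_fib_1: "gen_fib k 1 = 1"
  by (simp add: gen_fib.simps)

lemma gen_fib_rec: "n \<ge> 2 \<Longrightarrow> gen_fib k n = (\<Sum>i=1..k. gen_fib k (n - int i))"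
  by (subst gen_fib.simps) simp

definition gen_fib_root :: "nat \<Rightarrow> real" where
  "gen_fib_root k = (THE x. x > 0 \<and> x ^ k - (\<Sum>i<k. x ^ i) = 0)"

end

theory Submission
  imports Defs
begin

text \<open>
  Put \<open>x = 1 / \<alpha>\<close>, so that \<open>x + x\<^sup>2 + \<dots> + x\<^sup>k = 1\<close>, and let \<open>e n\<close> be the difference between
  \<open>F\<^sub>n\<close> and the approximation \<open>c \<alpha>\<^bsup>n - 1\<^esup>\<close>. Dividing the characteristic polynomial by \<open>X - \<alpha>\<close> leaves
  the coefficients \<open>b\<^sub>j = x + \<dots> + x\<^bsup>k - j\<^esup>\<close>, and the constant \<open>c\<close> is exactly the one for which \<open>e\<close>
  satisfies the shorter recurrence \<open>\<Sum>j<k. b\<^sub>j e (n - j) = 0\<close>. Subtracting two consecutive instances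
  gives \<open>e (n + 1) = \<Sum>j<k. x\<^bsup>k - j\<^esup> e (n - j)\<close>, a convex combination of the preceding \<open>k\<close> values.
  Hence \<open>\<bar>e n\<bar> < 1/2\<close> propagates from the \<open>k\<close> initial values to all \<open>n\<close>, and neither the other roots
  nor a Binet formula is needed.
\<close>

section \<open>The dominant root\<close>

lemma sum_powers_Suc: "(\<Sum>i=1..Suc m. x ^ i) = x + x * (\<Sum>i=1..m. x ^ i)"
  for x :: "'a :: comm_semiring_1"
proof (induction m)
  case (Suc m)
  have "(\<Sum>i=1..Suc (Suc m). x ^ i) = (\<Sum>i=1..Suc m. x ^ i) + x * x ^ Suc m"
    by simp
  also have "\<dots> = x + x * ((\<Sum>i=1..m. x ^ i) + x ^ Suc m)"
    unfolding Suc.IH by (simp only: distrib_left add.assoc)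
  finally show ?case
    by simp
qed simp

lemma sum_powers_closed: "(1 - x) * (\<Sum>i=1..m. x ^ i) = x - x ^ Suc m"
  for x :: "'a :: comm_ring_1"
  using sum_powers_Suc[of x m] by (simp add: algebra_simps)

text \<open>Multiplying by \<open>1 - x\<close> collapses the geometric sum. The resulting
  three-term equation is used later to eliminate \<open>x ^ Suc k\<close>.\<close>

lemma power_Suc_eq_of_sum_powers_eq_1:
  fixes x :: "'a :: comm_ring_1"
  assumes "(\<Sum>i=1..k. x ^ i) = 1"
  shows "x ^ Suc k = 2 * x - 1"
proof -
  have "1 - x = x - x ^ Suc k"
    using sum_powers_closed[of x k] unfolding assms by simp
  then show ?thesis
    by (simp add: algebra_simps)
qed

lemma sum_powers_strict_mono:
  fixes x y :: real
  assumes "0 \<le> x" "x < y" "k > 0"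
  shows "(\<Sum>i=1..k. x ^ i) < (\<Sum>i=1..k. y ^ i)"
  using assms by (intro sum_strict_mono) (auto intro!: power_strict_mono)

text \<open>Division by \<open>y ^ k\<close> gives an equation whose sum is strictly increasing in
  \<open>1 / y\<close> when \<open>k > 0\<close>, so uniqueness of the positive root becomes
  immediate.\<close>

lemma root_iff_sum_inverse_powers:
  fixes y :: real
  assumes "y > 0"
  shows "y ^ k - (\<Sum>i<k. y ^ i) = 0 \<longleftrightarrow> (\<Sum>i=1..k. (1 / y) ^ i) = 1"
proof -
  have "(\<Sum>i<k. y ^ i) = (\<Sum>i=1..k. y ^ (k - i))"
    by (rule sum.reindex_bij_witness[of _ "\<lambda>i. k - i" "\<lambda>i. k - i"]) auto
  also have "\<dots> = (\<Sum>i=1..k. y ^ k * (1 / y) ^ i)"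
    using assms by (intro sum.cong) (auto simp: power_diff power_divide)
  finally have "(\<Sum>i<k. y ^ i) = y ^ k * (\<Sum>i=1..k. (1 / y) ^ i)"
    by (simp add: sum_distrib_left)
  then show ?thesis
    using assms by auto
qed

text \<open>The sum is 0 at 0 and \<open>k \<ge> 2\<close> at 1, so the intermediate value theorem
  applies and neither endpoint is a solution.\<close>

lemma ex_sum_powers_eq_1:
  assumes "k \<ge> 2"
  obtains x :: real where "0 < x" "x < 1" "(\<Sum>i=1..k. x ^ i) = 1"
proof -
  let ?f = "\<lambda>x::real. \<Sum>i=1..k. x ^ i"
  have f0: "?f 0 = 0"
    by (intro sum.neutral) auto
  have "\<exists>x\<ge>0. x \<le> 1 \<and> ?f x = 1"
    using assms f0 by (intro IVT') (auto intro!: continuous_intros)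
  then obtain x where x: "0 \<le> x" "x \<le> 1" "?f x = 1"
    by blast
  have "x \<noteq> 0"
    using f0 x(3) by (metis zero_neq_one)
  moreover have "x \<noteq> 1"
    using assms x(3) by auto
  ultimately show thesis
    using that[of x] x by linarith
qed

lemma gen_fib_root_props:
  assumes "k \<ge> 2"
  shows "gen_fib_root k > 1" and "(\<Sum>i=1..k. (1 / gen_fib_root k) ^ i) = 1"
proof -
  obtain x :: real where x: "0 < x" "x < 1" "(\<Sum>i=1..k. x ^ i) = 1"
    using ex_sum_powers_eq_1[OF assms] .
  have "y = 1 / x" if "y > 0" "y ^ k - (\<Sum>i<k. y ^ i) = 0" for y
  proof -
    have "(\<Sum>i=1..k. (1 / y) ^ i) = 1"
      using that root_iff_sum_inverse_powers by blast
    moreover have "0 < 1 / y" "k > 0"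
      using that assms by auto
    ultimately have "1 / y = x"
      using x sum_powers_strict_mono[of "1 / y" x k] sum_powers_strict_mono[of x "1 / y" k]
      by (cases "1 / y" x rule: linorder_cases) auto
    then show ?thesis
      by auto
  qed
  moreover have "(1 / x) ^ k - (\<Sum>i<k. (1 / x) ^ i) = 0"
    using x root_iff_sum_inverse_powers[of "1 / x" k] by simp
  ultimately have "gen_fib_root k = 1 / x"
    unfolding gen_fib_root_def using x(1) by (intro the_equality) auto
  then show "gen_fib_root k > 1" "(\<Sum>i=1..k. (1 / gen_fib_root k) ^ i) = 1"
    using x by simp_all
qed

section \<open>The reduced recurrence\<close>

text \<open>For \<open>x = 1 / \<alpha>\<close> this is the coefficient of
  \<open>X ^ (k - 1 - j)\<close> in the quotient by \<open>X - \<alpha>\<close>. The empty sum at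
  \<open>j = k\<close> lets shifted sums keep the range \<open>j < k\<close>.\<close>

definition quot_coeff :: "nat \<Rightarrow> 'a :: comm_semiring_1 \<Rightarrow> nat \<Rightarrow> 'a" where
  "quot_coeff k x j = (\<Sum>i=1..k - j. x ^ i)"

lemma quot_coeff_self: "quot_coeff k x k = 0"
  by (simp add: quot_coeff_def)

text \<open>This is one step of synthetic division by \<open>X - 1 / x\<close>, multiplied by
  \<open>x\<close> to avoid inverses.\<close>

lemma quot_coeff_Suc_mult:
  assumes "j < k"
  shows "quot_coeff k x j = x + x * quot_coeff k x (Suc j)"
  using assms sum_powers_Suc[of x "k - Suc j"] by (simp add: quot_coeff_def Suc_diff_Suc)

lemma quot_coeff_Suc_add:
  assumes "j < k"
  shows "quot_coeff k x j = quot_coeff k x (Suc j) + x ^ (k - j)"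
proof -
  have "k - j = Suc (k - Suc j)"
    using assms by simp
  then show ?thesis
    unfolding quot_coeff_def by simp
qed

lemma quot_coeff_nonneg: "x \<ge> 0 \<Longrightarrow> quot_coeff k x j \<ge> 0" for x :: real
  by (auto simp: quot_coeff_def intro: sum_nonneg)

lemma quot_sum_shift:
  fixes e :: "int \<Rightarrow> 'a :: comm_ring_1"
  assumes "quot_coeff k x 0 = 1" "k > 0"
  shows "(\<Sum>j<k. quot_coeff k x j * e (n - int j)) =
    e n + (\<Sum>j<k. quot_coeff k x (Suc j) * e (n - 1 - int j))"
proof -
  obtain k' where k': "k = Suc k'"
    using assms(2) gr0_implies_Suc by blast
  have "(\<Sum>j<Suc k'. quot_coeff k x j * e (n - int j)) =
    e n + (\<Sum>j<k'. quot_coeff k x (Suc j) * e (n - 1 - int j))"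
    unfolding sum.lessThan_Suc_shift using assms(1) by (simp add: algebra_simps)
  moreover have "quot_coeff k x (Suc k') = 0"
    using quot_coeff_self k' by metis
  ultimately show ?thesis
    unfolding k' by simp
qed

text \<open>Since the quotient times \<open>X - 1 / x\<close> is the characteristic polynomial,
  \<open>x\<close> times the sum at \<open>n + 1\<close> equals the sum at \<open>n\<close>. As
  \<open>x \<noteq> 0\<close>, the value 0 propagates.\<close>

lemma quot_sum_eq_0:
  fixes e :: "int \<Rightarrow> 'a :: idom"
  assumes x: "quot_coeff k x 0 = 1" "x \<noteq> 0" "k > 0"
    and rec: "\<And>n. n \<ge> 2 \<Longrightarrow> e n = (\<Sum>i=1..k. e (n - int i))"
    and init: "(\<Sum>j<k. quot_coeff k x j * e (1 - int j)) = 0"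
    and "n \<ge> 1"
  shows "(\<Sum>j<k. quot_coeff k x j * e (n - int j)) = 0"
  using \<open>n \<ge> 1\<close>
proof (induction n rule: int_ge_induct)
  case base
  show ?case by (rule init)
next
  case (step n)
  have "(\<Sum>i=1..k. e (n + 1 - int i)) = (\<Sum>j<k. e (n - int j))"
    by (rule sum.reindex_bij_witness[of _ Suc "\<lambda>i. i - 1"])
      (auto simp: of_nat_diff algebra_simps)
  with rec[of "n + 1"] step.hyps have e: "e (n + 1) = (\<Sum>j<k. e (n - int j))"
    by simp
  have "x * (\<Sum>j<k. quot_coeff k x j * e (n + 1 - int j)) =
      x * e (n + 1) + (\<Sum>j<k. x * quot_coeff k x (Suc j) * e (n - int j))"
    unfolding quot_sum_shift[OF x(1,3)] by (simp add: algebra_simps sum_distrib_left)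
  \<comment> \<open>Expanding \<open>e (n + 1)\<close> by the full recurrence adds \<open>x\<close>
    to every coefficient.\<close>
  also have "\<dots> = (\<Sum>j<k. (x + x * quot_coeff k x (Suc j)) * e (n - int j))"
    unfolding e by (simp add: algebra_simps sum_distrib_left sum.distrib)
  also have "\<dots> = (\<Sum>j<k. quot_coeff k x j * e (n - int j))"
    by (intro sum.cong) (simp_all add: quot_coeff_Suc_mult)
  finally show ?case
    using step.IH x(2) by simp
qed

lemma convex_recurrence:
  fixes e :: "int \<Rightarrow> 'a :: idom"
  assumes x: "quot_coeff k x 0 = 1" "x \<noteq> 0" "k > 0"
    and rec: "\<And>n. n \<ge> 2 \<Longrightarrow> e n = (\<Sum>i=1..k. e (n - int i))"
    and init: "(\<Sum>j<k. quot_coeff k x j * e (1 - int j)) = 0"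
    and n: "n \<ge> 2"
  shows "e n = (\<Sum>j<k. x ^ (k - j) * e (n - 1 - int j))"
proof -
  note zero = quot_sum_eq_0[of k x e, OF x rec init]
  have "0 = e n + (\<Sum>j<k. quot_coeff k x (Suc j) * e (n - 1 - int j))"
    using zero[of n] n quot_sum_shift[OF x(1,3), of e n] by simp
  moreover have "(\<Sum>j<k. quot_coeff k x j * e (n - 1 - int j)) =
      (\<Sum>j<k. quot_coeff k x (Suc j) * e (n - 1 - int j)) + (\<Sum>j<k. x ^ (k - j) * e (n - 1 - int j))"
    unfolding sum.distrib[symmetric]
    by (intro sum.cong) (simp_all add: quot_coeff_Suc_add algebra_simps)
  moreover have "(\<Sum>j<k. quot_coeff k x j * e (n - 1 - int j)) = 0"
    using zero[of "n - 1"] n by simp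
  ultimately show ?thesis
    by (metis add.commute add_left_cancel)
qed

text \<open>The weights are positive with sum 1, so a strict bound on \<open>k\<close> consecutive
  values passes to the next one.\<close>

lemma abs_bound_of_convex_recurrence:
  fixes e :: "int \<Rightarrow> real"
  assumes x: "(\<Sum>i=1..k. x ^ i) = 1" "x > 0" "k > 0"
    and rec: "\<And>n. n \<ge> 2 \<Longrightarrow> e n = (\<Sum>j<k. x ^ (k - j) * e (n - 1 - int j))"
    and init: "\<And>n. 2 - int k \<le> n \<Longrightarrow> n \<le> 1 \<Longrightarrow> \<bar>e n\<bar> < B"
    and "n \<ge> 2 - int k"
  shows "\<bar>e n\<bar> < B"
  using \<open>n \<ge> 2 - int k\<close>
\<comment> \<open>The shift by \<open>k\<close> makes the measure faithful on the nonpositive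
  indices too.\<close>
proof (induction "nat (n + int k)" arbitrary: n rule: less_induct)
  case less
  show ?case
  proof (cases "n \<le> 1")
    case True
    then show ?thesis using init less.prems by simp
  next
    case False
    have IH: "\<bar>e (n - 1 - int j)\<bar> < B" if "j < k" for j
      using False that by (intro less.hyps) auto
    have "\<bar>e n\<bar> \<le> (\<Sum>j<k. \<bar>x ^ (k - j) * e (n - 1 - int j)\<bar>)"
      using rec[of n] False by (simp add: sum_abs)
    also have "\<dots> < (\<Sum>j<k. x ^ (k - j) * B)"
      using x IH by (intro sum_strict_mono) (auto simp: abs_mult)
    also have "\<dots> = (\<Sum>i=1..k. x ^ i) * B"
      unfolding sum_distrib_right
      by (rule sum.reindex_bij_witness[of _ "\<lambda>i. k - i" "\<lambda>i. k - i"]) auto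
    finally show ?thesis
      using x(1) by simp
  qed
qed

section \<open>The leading coefficient\<close>

text \<open>The sum over \<open>j\<close> is the quotient polynomial at \<alpha> divided by
  \<open>\<alpha> ^ (k - 1)\<close>, where \<open>x = 1 / \<alpha>\<close>. Its reciprocal will be
  the leading coefficient.\<close>

lemma quot_coeff_gen_fun:
  fixes x :: real
  assumes "(\<Sum>i=1..k. x ^ i) = 1"
  shows "(1 - x) * (\<Sum>j<k. quot_coeff k x j * x ^ j) = 1 - real k * x ^ Suc k"
proof -
  have "(1 - x) * (quot_coeff k x j * x ^ j) = x ^ Suc j - x ^ Suc k" if "j < k" for j
  proof -
    have "(1 - x) * (quot_coeff k x j * x ^ j) = (x - x ^ Suc (k - j)) * x ^ j"
      unfolding quot_coeff_def mult.assoc[symmetric] sum_powers_closed ..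
    also have "\<dots> = x ^ Suc j - x ^ (Suc (k - j) + j)"
      unfolding power_add by (simp add: algebra_simps)
    finally show ?thesis
      using that by simp
  qed
  then have "(1 - x) * (\<Sum>j<k. quot_coeff k x j * x ^ j) = (\<Sum>j<k. x ^ Suc j - x ^ Suc k)"
    unfolding sum_distrib_left by (intro sum.cong) auto
  also have "\<dots> = (\<Sum>j<k. x ^ Suc j) - real k * x ^ Suc k"
    by (simp add: sum_subtractf)
  also have "(\<Sum>j<k. x ^ Suc j) = (\<Sum>i=1..k. x ^ i)"
    by (rule sum.reindex_bij_witness[of _ "\<lambda>i. i - 1" Suc]) auto
  finally show ?thesis
    using assms by simp
qed

text \<open>The first two terms alone contribute at least \<open>1 + x * x\<close>, which exceeds
  \<open>2 * x\<close> because \<open>x \<noteq> 1\<close>.\<close>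

lemma quot_coeff_gen_fun_gt:
  fixes x :: real
  assumes "k \<ge> 2" "0 < x" "x < 1" "(\<Sum>i=1..k. x ^ i) = 1"
  shows "(\<Sum>j<k. quot_coeff k x j * x ^ j) > 2 * x"
proof -
  have "x ^ 1 \<le> quot_coeff k x 1"
    unfolding quot_coeff_def using assms by (intro member_le_sum) auto
  then have "x * x \<le> quot_coeff k x 1 * x"
    using assms by simp
  moreover have "quot_coeff k x 0 = 1"
    using assms(4) by (simp add: quot_coeff_def)
  ultimately have "1 + x * x \<le> (\<Sum>j<2. quot_coeff k x j * x ^ j)"
    by (simp add: numeral_2_eq_2)
  also have "\<dots> \<le> (\<Sum>j<k. quot_coeff k x j * x ^ j)"
    using assms by (intro sum_mono2) (auto intro!: mult_nonneg_nonneg quot_coeff_nonneg)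
  finally have "1 + x * x \<le> (\<Sum>j<k. quot_coeff k x j * x ^ j)" .
  moreover have "(1 - x) * (1 - x) > 0"
    using assms by simp
  ultimately show ?thesis
    by (simp add: algebra_simps)
qed

text \<open>Replacing \<open>k\<close> by 1 in \<open>1 - k * x ^ Suc k\<close> increases it to
  \<open>1 - x ^ Suc k = 2 * (1 - x)\<close>.\<close>

lemma quot_coeff_gen_fun_less_2:
  fixes x :: real
  assumes "k \<ge> 2" "0 < x" "x < 1" "(\<Sum>i=1..k. x ^ i) = 1"
  shows "(\<Sum>j<k. quot_coeff k x j * x ^ j) < 2"
proof -
  note power_Suc_eq_of_sum_powers_eq_1[OF assms(4)]
  moreover have "1 * x ^ Suc k < real k * x ^ Suc k"
    using assms by (intro mult_strict_right_mono) auto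
  ultimately have "(1 - x) * (\<Sum>j<k. quot_coeff k x j * x ^ j) < (1 - x) * 2"
    unfolding quot_coeff_gen_fun[OF assms(4)] by simp
  then show ?thesis
    using assms(3) by (subst (asm) mult_less_cancel_left_pos) auto
qed

lemma leading_coeff_eq:
  fixes \<alpha> :: real
  assumes "\<alpha> > 1" "(\<Sum>i=1..k. (1 / \<alpha>) ^ i) = 1"
  shows "(\<alpha> - 1) / (2 + (real k + 1) * (\<alpha> - 2)) =
    1 / (\<Sum>j<k. quot_coeff k (1 / \<alpha>) j * (1 / \<alpha>) ^ j)" (is "_ = 1 / ?S")
proof -
  have "(1 - 1 / \<alpha>) * ?S = 1 - real k * (2 * (1 / \<alpha>) - 1)"
    using quot_coeff_gen_fun[OF assms(2)] unfolding power_Suc_eq_of_sum_powers_eq_1[OF assms(2)] .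
  then have "(\<alpha> - 1) * ?S = 2 + (real k + 1) * (\<alpha> - 2)"
    using assms(1) by (simp add: field_simps)
  then show ?thesis
    using assms(1) by (metis divide_divide_eq_left divide_self diff_gt_0_iff_gt less_irrefl)
qed

lemma geometric_recurrence:
  fixes \<alpha> :: real
  assumes "\<alpha> > 0" "(\<Sum>i=1..k. (1 / \<alpha>) ^ i) = 1"
  shows "(\<Sum>i=1..k. \<alpha> powi (n - int i)) = \<alpha> powi n"
proof -
  have "(\<Sum>i=1..k. \<alpha> powi (n - int i)) = (\<Sum>i=1..k. \<alpha> powi n * (1 / \<alpha>) ^ i)"
    using assms(1) by (intro sum.cong) (auto simp: power_int_diff power_divide)
  also have "\<dots> = \<alpha> powi n"
    unfolding sum_distrib_left[symmetric] assms(2) by simp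
  finally show ?thesis .
qed

theorem theorem2:
  fixes k :: nat and n :: int and \<alpha> :: real
  assumes "k \<ge> 2"
    and "\<alpha> = gen_fib_root k"
    and "n \<ge> 2 - int k"
  shows "gen_fib k n
           = round ((\<alpha> - 1) / (2 + (real k + 1) * (\<alpha> - 2)) * \<alpha> powi (n - 1))"
proof -
  define x where "x = 1 / \<alpha>"
  define S where "S = (\<Sum>j<k. quot_coeff k x j * x ^ j)"
  define e where "e = (\<lambda>n. real_of_int (gen_fib k n) - 1 / S * \<alpha> powi (n - 1))"
  have \<alpha>: "\<alpha> > 1" and sum_x: "(\<Sum>i=1..k. x ^ i) = 1"
    using gen_fib_root_props[OF assms(1)] assms(2) by (simp_all add: x_def)
  have x: "0 < x" "x < 1" "k > 0" "x \<noteq> 0"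
    using \<alpha> assms(1) by (auto simp: x_def)
  have q0: "quot_coeff k x 0 = 1"
    using sum_x by (simp add: quot_coeff_def)
  have S: "2 * x < S" "S < 2"
    unfolding S_def using assms(1) x sum_x
    by (auto intro!: quot_coeff_gen_fun_gt quot_coeff_gen_fun_less_2)
  then have "S > 0"
    using x by linarith
  \<comment> \<open>Positivity of \<open>x ^ Suc k = 2 * x - 1\<close>.\<close>
  have half: "1 / 2 < x"
    using zero_less_power[OF x(1), of "Suc k"]
    unfolding power_Suc_eq_of_sum_powers_eq_1[OF sum_x] by simp
  have rec: "e n = (\<Sum>i=1..k. e (n - int i))" if "n \<ge> 2" for n
  proof -
    have "(\<Sum>i=1..k. e (n - int i)) =
        real_of_int (\<Sum>i=1..k. gen_fib k (n - int i)) - 1 / S * (\<Sum>i=1..k. \<alpha> powi ((n - 1) - int i))"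
      unfolding e_def sum_subtractf sum_distrib_left of_int_sum by (simp add: algebra_simps)
    also have "\<dots> = e n"
      using gen_fib_rec[OF that, of k] geometric_recurrence[of \<alpha> k "n - 1"] \<alpha> sum_x
      by (simp add: e_def x_def)
    finally show ?thesis ..
  qed
  \<comment> \<open>Here the factor \<open>1 / S\<close> is forced: only \<open>j = 0\<close> meets
    a nonzero Fibonacci number, so the sum is \<open>1 - 1 / S * S\<close>.\<close>
  have init: "(\<Sum>j<k. quot_coeff k x j * e (1 - int j)) = 0"
  proof -
    have "e (1 - int j) = of_bool (j = 0) - 1 / S * x ^ j" for j
      using \<alpha> by (auto simp: e_def x_def gen_fib.simps power_int_minus power_divide field_simps)
    then have "(\<Sum>j<k. quot_coeff k x j * e (1 - int j)) =
        (\<Sum>j<k. if j = 0 then quot_coeff k x j else 0) - 1 / S * S"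
      by (subst (2) S_def, unfold sum_distrib_left sum_subtractf[symmetric], intro sum.cong)
        (simp_all add: right_diff_distrib)
    also have "\<dots> = 0"
      using q0 x S by (simp add: sum.delta)
    finally show ?thesis .
  qed
  have small: "\<bar>e m\<bar> < 1 / 2" if "2 - int k \<le> m" "m \<le> 1" for m
  proof (cases "m = 1")
    case True
    \<comment> \<open>From \<open>1 < 2 * x < S < 2\<close>, the error
      \<open>e 1 = 1 - 1 / S\<close> lies between 0 and 1/2.\<close>
    have "1 / 2 < 1 / S" "1 / S < 1"
      using S x half by (simp_all add: field_simps)
    then show ?thesis
      using True by (simp add: e_def gen_fib_1 abs_if)
  next
    case False
    \<comment> \<open>For \<open>m \<le> 0\<close> the approximation is largest at
      \<open>m = 0\<close>, where it equals \<open>x / S\<close>.\<close>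
    have "\<alpha> powi (m - 1) \<le> \<alpha> powi (-1)"
      using False that \<alpha> by (intro power_int_increasing) auto
    also have "\<dots> = x"
      by (simp add: x_def power_int_minus field_simps)
    finally have "1 / S * \<alpha> powi (m - 1) \<le> 1 / S * x"
      using \<open>S > 0\<close> by (intro mult_left_mono) auto
    also have "\<dots> < 1 / 2"
      using S(1) \<open>S > 0\<close> by (simp add: field_simps)
    finally have "1 / S * \<alpha> powi (m - 1) < 1 / 2" .
    moreover have "1 / S * \<alpha> powi (m - 1) \<ge> 0"
      using \<open>S > 0\<close> \<alpha> by simp
    moreover have "gen_fib k m = 0"
      using False that by (intro gen_fib_nonpos) auto
    ultimately show ?thesis
      by (simp add: e_def)
  qed
  have convex: "e m = (\<Sum>j<k. x ^ (k - j) * e (m - 1 - int j))" if "m \<ge> 2" for m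
    using convex_recurrence[OF q0 x(4,3) rec init that] .
  have "\<bar>e n\<bar> < 1 / 2"
    using abs_bound_of_convex_recurrence[OF sum_x x(1,3) convex small assms(3)] .
  then have "round (1 / S * \<alpha> powi (n - 1)) = gen_fib k n"
    by (intro round_unique') (simp add: e_def abs_minus_commute)
  then show ?thesis
    using leading_coeff_eq[of \<alpha> k] \<alpha> sum_x by (simp add: S_def x_def)
qed

end
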